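(* Let $\lambda$ be a nonzero real number. For every integer $r\ge0$ and every real $x$, $$ \sum_{k=0}^{\infty}\frac{(k)_{r,\lambda}}{k!}\cos kx=e^{\cos x}\bigg(\cos(\sin x)\sum_{j=0}^{r}{r \brace j}_{\lambda}\cos jx-\sin(\sin x)\sum_{j=0}^{r}{r \brace j}_{\lambda}\sin jx\bigg), $$ and $$ \sum_{k=0}^{\infty}\frac{(k)_{r,\lambda}}{k!}\sin kx=e^{\cos x}\bigg(\cos(\sin x)\sum_{j=0}^{r}{r \brace j}_{\lambda}\sin jx+\sin(\sin x)\sum_{j=0}^{r}{r \brace j}_{\lambda}\cos jx\bigg). $$
   Context: For a real parameter $\mu$ the degenerate falling factorials are $(x)_{0,\mu}=1$ and $(x)_{n,\mu}=x(x-\mu)\cdots(x-(n-1)\mu)$ for $n\ge1$; $(x)_n=(x)_{n,1}$ is the usual falling factorial. The degenerate Stirling numbers of the second kind ${n \brace k}_{\mu}$ are defined by $(x)_{n,\mu}=\sum_{k=0}^{n}{n \brace k}_{\mu}(x)_k$. *)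

theory Defs
  imports Complex_Main
begin

definition degen_ffact :: "real \<Rightarrow> nat \<Rightarrow> real \<Rightarrow> real" where
  "degen_ffact \<mu> n x = (\<Prod>i<n. x - real i * \<mu>)"

text \<open>
  The coefficients of the degenerate falling factorial in the basis of ordinary falling
  factorials. The identity only constrains the indices up to \<open>n\<close>; the others are set to \<open>0\<close>.
  The lemma \<open>degen_stirling2_ex1\<close> below shows that the description is a proper one.
\<close>

definition degen_stirling2 :: "real \<Rightarrow> nat \<Rightarrow> nat \<Rightarrow> real" where
  "degen_stirling2 \<mu> n =
     (THE S. (\<forall>k>n. S k = 0) \<and>
             (\<forall>x. degen_ffact \<mu> n x = (\<Sum>k=0..n. S k * degen_ffact 1 k x)))"

lemma degen_ffact_0 [simp]: "degen_ffact \<mu> 0 x = 1"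
  by (simp add: degen_ffact_def)

lemma degen_ffact_Suc: "degen_ffact \<mu> (Suc n) x = degen_ffact \<mu> n x * (x - real n * \<mu>)"
  by (simp add: degen_ffact_def)

lemma degen_ffact_1_eq_0: "m < k \<Longrightarrow> degen_ffact 1 k (real m) = 0"
  by (auto simp: degen_ffact_def)

lemma degen_ffact_1_neq_0: "degen_ffact 1 m (real m) \<noteq> 0"
  by (auto simp: degen_ffact_def)

lemma degen_ffact_1_lin_indep:
  assumes "\<And>x. (\<Sum>k=0..n. d k * degen_ffact 1 k x) = 0" and "m \<le> n"
  shows "d m = 0"
  using \<open>m \<le> n\<close>
proof (induction m rule: less_induct)
  case (less m)
  have "(\<Sum>k=0..n. d k * degen_ffact 1 k (real m)) =
        (\<Sum>k=0..n. if k = m then d m * degen_ffact 1 m (real m) else 0)"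
  proof (rule sum.cong)
    fix k assume "k \<in> {0..n}"
    then show "d k * degen_ffact 1 k (real m) = (if k = m then d m * degen_ffact 1 m (real m) else 0)"
      using less by (cases k m rule: linorder_cases) (auto simp: degen_ffact_1_eq_0)
  qed simp
  also have "\<dots> = d m * degen_ffact 1 m (real m)"
    using less.prems by simp
  finally show ?case
    using assms(1)[of "real m"] degen_ffact_1_neq_0[of m] by simp
qed

lemma degen_stirling2_exists:
  "\<exists>S. (\<forall>k>n. S k = 0) \<and> (\<forall>x. degen_ffact \<mu> n x = (\<Sum>k=0..n. S k * degen_ffact 1 k x))"
proof (induction n)
  case 0
  show ?case
    by (rule exI[of _ "\<lambda>k. if k = 0 then 1 else 0"]) simp
next
  case (Suc n)
  then obtain S where S0: "\<And>k. k > n \<Longrightarrow> S k = 0"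
    and S: "\<And>x. degen_ffact \<mu> n x = (\<Sum>k=0..n. S k * degen_ffact 1 k x)"
    by blast
  define T where "T k = (if k = 0 then 0 else S (k - 1)) + (real k - real n * \<mu>) * S k" for k
  have "degen_ffact \<mu> (Suc n) x = (\<Sum>k=0..Suc n. T k * degen_ffact 1 k x)" for x
  proof -
    have "degen_ffact \<mu> (Suc n) x = (\<Sum>k=0..n. S k * degen_ffact 1 k x * (x - real n * \<mu>))"
      by (simp add: degen_ffact_Suc S sum_distrib_right)
    also have "\<dots> = (\<Sum>k=0..n. S k * degen_ffact 1 (Suc k) x) +
        (\<Sum>k=0..n. (real k - real n * \<mu>) * S k * degen_ffact 1 k x)"
      by (simp add: degen_ffact_Suc algebra_simps flip: sum.distrib)
    also have "(\<Sum>k=0..n. S k * degen_ffact 1 (Suc k) x) =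
        (\<Sum>k=0..Suc n. (if k = 0 then 0 else S (k - 1)) * degen_ffact 1 k x)"
      by (subst sum.atLeast0_atMost_Suc_shift) simp
    also have "(\<Sum>k=0..n. (real k - real n * \<mu>) * S k * degen_ffact 1 k x) =
        (\<Sum>k=0..Suc n. (real k - real n * \<mu>) * S k * degen_ffact 1 k x)"
      by (simp add: S0)
    finally show ?thesis
      by (simp only: T_def distrib_right sum.distrib)
  qed
  moreover have "\<forall>k>Suc n. T k = 0"
    by (simp add: T_def S0)
  ultimately show ?case by blast
qed

lemma degen_stirling2_ex1:
  "\<exists>!S. (\<forall>k>n. S k = 0) \<and> (\<forall>x. degen_ffact \<mu> n x = (\<Sum>k=0..n. S k * degen_ffact 1 k x))"
proof (rule ex_ex1I[OF degen_stirling2_exists])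
  fix S T
  assume S: "(\<forall>k>n. S k = 0) \<and> (\<forall>x. degen_ffact \<mu> n x = (\<Sum>k=0..n. S k * degen_ffact 1 k x))"
    and T: "(\<forall>k>n. T k = 0) \<and> (\<forall>x. degen_ffact \<mu> n x = (\<Sum>k=0..n. T k * degen_ffact 1 k x))"
  have "(\<Sum>k=0..n. (S k - T k) * degen_ffact 1 k x) = 0" for x
    using S T by (simp add: left_diff_distrib sum_subtractf)
  then have "S k - T k = 0" if "k \<le> n" for k
    using that by (rule degen_ffact_1_lin_indep)
  then show "S = T"
    using S T by (metis eq_iff_diff_eq_0 ext not_le)
qed

lemma degen_ffact_eq_sum_degen_stirling2:
  "degen_ffact \<mu> n x = (\<Sum>k=0..n. degen_stirling2 \<mu> n k * degen_ffact 1 k x)"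
  using theI'[OF degen_stirling2_ex1[of n \<mu>]] unfolding degen_stirling2_def by blast

end

theory Submission imports Defs begin

text \<open>
  Since \<open>(k)\<^sub>j / k! = 1 / (k - j)!\<close> for \<open>k \<ge> j\<close> and \<open>(k)\<^sub>j = 0\<close> for \<open>k < j\<close>, shifting the
  exponential series gives \<open>\<Sum>k. (k)\<^sub>j / k! * z ^ k = z ^ j * exp z\<close>. Expanding the degenerate
  falling factorial in ordinary ones and taking real and imaginary parts at \<open>z = cis x\<close> yields
  both identities.
\<close>

text \<open>Shifting the argument by \<open>j\<close> avoids truncated subtraction. In the induction
  the last factor of the falling factorial is \<open>k + 1\<close>, which turns
  \<open>1 / fact (Suc k)\<close> into \<open>1 / fact k\<close>; hence \<open>k\<close> is
  arbitrary.\<close>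

lemma degen_ffact_1_div_fact:
  "degen_ffact 1 j (real (k + j)) / fact (k + j) = 1 / fact k"
proof (induction j arbitrary: k)
  case 0
  show ?case by simp
next
  case (Suc j)
  have "degen_ffact 1 (Suc j) (real (k + Suc j)) / fact (k + Suc j) =
        degen_ffact 1 j (real (Suc k + j)) / fact (Suc k + j) * (real k + 1)"
    by (simp add: degen_ffact_Suc)
  also have "\<dots> = 1 / fact (Suc k) * (real k + 1)"
    by (simp only: Suc.IH)
  also have "\<dots> = 1 / fact k"
    using of_nat_neq_0[of k, where 'a = real] by (simp add: divide_simps)
  finally show ?case .
qed

lemma sums_degen_ffact_1_exp:
  fixes z :: "'a :: {banach, real_normed_field}"
  shows "(\<lambda>k. of_real (degen_ffact 1 j (real k) / fact k) * z ^ k) sums (z ^ j * exp z)"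
proof -
  have "(\<lambda>k. of_real (degen_ffact 1 j (real (k + j)) / fact (k + j)) * z ^ (k + j))
          = (\<lambda>k. z ^ j * (z ^ k /\<^sub>R fact k))"
    unfolding degen_ffact_1_div_fact
    by (simp add: fun_eq_iff power_add scaleR_conv_of_real field_simps)
  then have "(\<lambda>k. of_real (degen_ffact 1 j (real (k + j)) / fact (k + j)) * z ^ (k + j))
          sums (z ^ j * exp z)"
    by (simp only: sums_mult[OF exp_converges])
  then show ?thesis
    \<comment> \<open>The terms of index below \<open>j\<close> vanish, so undoing the shift leaves
      the sum unchanged.\<close>
    by (subst (asm) sums_zero_iff_shift) (simp_all add: degen_ffact_1_eq_0)
qed

text \<open>A degenerate Dobinski formula: a finite linear combination of the preceding series over
  \<open>j\<close>.\<close>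

lemma sums_degen_ffact_exp:
  fixes z :: "'a :: {banach, real_normed_field}"
  shows "(\<lambda>k. of_real (degen_ffact \<mu> r (real k) / fact k) * z ^ k) sums
           ((\<Sum>j=0..r. of_real (degen_stirling2 \<mu> r j) * z ^ j) * exp z)"
proof -
  have "(\<lambda>k. \<Sum>j=0..r. of_real (degen_stirling2 \<mu> r j) *
            (of_real (degen_ffact 1 j (real k) / fact k) * z ^ k)) sums
          (\<Sum>j=0..r. of_real (degen_stirling2 \<mu> r j) * (z ^ j * exp z))"
    by (intro sums_sum sums_mult sums_degen_ffact_1_exp)
  then show ?thesis
    by (simp add: degen_ffact_eq_sum_degen_stirling2[of \<mu> r] sum_distrib_right sum_divide_distrib
        mult.assoc)
qed

theorem theorem2p14:
  fixes lam x :: real and r :: nat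
  assumes "lam \<noteq> 0"
  shows "(\<lambda>k::nat. degen_ffact lam r (real k) / fact k * cos (real k * x)) sums
           (exp (cos x) *
             (cos (sin x) * (\<Sum>j=0..r. degen_stirling2 lam r j * cos (real j * x)) -
              sin (sin x) * (\<Sum>j=0..r. degen_stirling2 lam r j * sin (real j * x))))
       \<and> (\<lambda>k::nat. degen_ffact lam r (real k) / fact k * sin (real k * x)) sums
           (exp (cos x) *
             (cos (sin x) * (\<Sum>j=0..r. degen_stirling2 lam r j * sin (real j * x)) +
              sin (sin x) * (\<Sum>j=0..r. degen_stirling2 lam r j * cos (real j * x))))"
proof -
  define S where "S = (\<Sum>j=0..r. complex_of_real (degen_stirling2 lam r j) * cis x ^ j)"
  have sums: "(\<lambda>k. complex_of_real (degen_ffact lam r (real k) / fact k) * cis x ^ k) sums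
      (S * exp (cis x))"
    unfolding S_def by (rule sums_degen_ffact_exp)
  have S: "Re S = (\<Sum>j=0..r. degen_stirling2 lam r j * cos (real j * x))"
    "Im S = (\<Sum>j=0..r. degen_stirling2 lam r j * sin (real j * x))"
    by (simp_all add: S_def Complex.DeMoivre)
  \<comment> \<open>Here \<open>exp (cis x)\<close> has modulus \<open>exp (cos x)\<close> and
    argument \<open>sin x\<close>; multiplying by \<open>S\<close> gives the two combinations.
    Deleting \<open>of_real_divide\<close> keeps each coefficient a single embedded real, which
    passes through \<open>Re\<close> and \<open>Im\<close>.\<close>
  show ?thesis
    using sums_Re[OF sums] sums_Im[OF sums]
    by (simp add: Complex.DeMoivre Re_exp Im_exp S del: of_real_divide)
      (simp add: algebra_simps)
qed

end
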